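(* Let $n=2$, $C\in\mathbb Z_{\ge1}$ and $q\in[0,1)^2$. Let $\pi_{\mathsf{EA}}$ be a greedy effective assignment policy and $\pi_{\mathsf{FA}}$ a fair allocation policy such that, in each round $t$, both assign the first $\min\{C,|\mathcal M_t|\}$ effectors to distinct active threats following the same index order for the threats $i\in\mathcal M_t$. Then for all $\tau\ge1$, $$V^{\pi_{\mathsf{EA}}}_{\mathsf{EAM}_\tau}\ge V^{\pi_{\mathsf{FA}}}_{\mathsf{EAM}_\tau}.$$
   Context: Model. An instance has $n\ge1$ threats $[n]=\{1,\dots,n\}$, a per-round capacity $C\in\mathbb Z_{\ge1}$ of effectors, and difficulties $q=(q_i)\in[0,1)^n$, where $q_i$ is the probability that a single effector fails to neutralize threat $i$. Demands $L_1,\dots,L_n$ are independent, $L_i\sim\mathrm{Geom}(1-q_i)$ on $\{1,2,\dots\}$, i.e. $\Pr(L_i>k)=q_i^k$ (with $0^0=1$). $\mathcal M_t\subseteq[n]$ is the set of active threats at the start of round $t$, $\mathcal M_1=[n]$. A policy is $\pi=(\pi_t)_{t\ge1}$, where $\pi_t$ maps each subset $\mathcal M\subseteq[n]$ to a vector $\pi_t(\mathcal M)\in\mathbb Z_{\ge0}^n$ with $\sum_{i\in[n]}[\pi_t(\mathcal M)]_i\le C$ and, for every nonempty $\mathcal M$ and every $t$, $\sum_{i\in\mathcal M}[\pi_t(\mathcal M)]_i=C$; $\Pi$ is the set of all such policies. Under $\pi$, the round-$t$ allocation is $x^t=\pi_t(\mathcal M_t)$ and $\mathcal M_{t+1}=\{i\in\mathcal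 M_t:\sum_{\ell=1}^t x_i^\ell<L_i\}$. Objective. $V^\pi_{\mathsf{EAM}_\tau}=\mathbb E\big[\sum_{i=1}^n\min\{\sum_{t=1}^\tau x_i^t,L_i\}\big]$. Fair allocation. For nonempty $\mathcal M$, $x\in\mathbb Z_{\ge0}^n$ is fair for $\mathcal M$ if $\sum_{i\in\mathcal M}x_i=C$, $x_i=0$ for $i\notin\mathcal M$, and $|x_i-x_j|\in\{0,1\}$ for all $i,j\in\mathcal M$. A fair allocation policy is a $\pi\in\Pi$ with $\pi_t(\mathcal M)$ fair for $\mathcal M$ for all nonempty $\mathcal M$ and all $t$. Greedy effective assignment policy. A policy $\pi\in\Pi$ such that for every $t$ and nonempty $\mathcal M$, $\pi_t(\mathcal M)$ is an output of: start with $x_i=0$ for all $i$; for $k=1,\dots,C$, choose $i^*\in\arg\max_{i\in\mathcal M}q_i^{x_i}$ (ties broken by some rule) and increase $x_{i^*}$ by $1$. The condition on the first $\min\{C,|\mathcal M_t|\}$ effectors is only a common tie-breaking convention: the two policies give their first effectors, one each, to active threats in a common order (so e.g. if $C<|\mathcal M_t|$ they serve the same threats). *)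

theory Defs
  imports "HOL-Probability.Probability"
begin

text \<open>
  Threats are the naturals \<open>1, \<dots>, n\<close>, and rounds are numbered from 1.  An allocation vector is a
  function on threats of which only the values on \<open>{1..n}\<close> matter; likewise only the values of a
  policy at rounds \<open>t \<ge> 1\<close> and at sets \<open>M \<subseteq> {1..n}\<close> matter.
\<close>

type_synonym alloc = "nat \<Rightarrow> nat"
type_synonym policy = "nat \<Rightarrow> nat set \<Rightarrow> alloc"

definition is_policy :: "nat \<Rightarrow> nat \<Rightarrow> policy \<Rightarrow> bool" where
  "is_policy n C \<pi> \<longleftrightarrow>
     (\<forall>t\<ge>1. \<forall>M\<subseteq>{1..n}.
        (\<Sum>i\<in>{1..n}. \<pi> t M i) \<le> C \<and> (M \<noteq> {} \<longrightarrow> (\<Sum>i\<in>M. \<pi> t M i) = C))"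


subsection \<open>Demands\<close>

text \<open>\<^const>\<open>geometric_pmf\<close> counts failures before the first success; shifting it by one
  gives the geometric law on \<open>{1, 2, \<dots>}\<close>.\<close>

definition demands :: "nat \<Rightarrow> (nat \<Rightarrow> real) \<Rightarrow> (nat \<Rightarrow> nat) pmf" where
  "demands n q = Pi_pmf {1..n} 0 (\<lambda>i. map_pmf Suc (geometric_pmf (1 - q i)))"

lemma prob_demands_gt:
  assumes "i \<in> {1..n}" "0 \<le> q i" "q i < 1"
  shows "measure_pmf.prob (demands n q) {L. L i > k} = q i ^ k"
proof -
  let ?p = "1 - q i"
  let ?G = "geometric_pmf ?p"
  have "measure_pmf.prob (demands n q) {L. L i > k} =
      measure_pmf.prob (map_pmf (\<lambda>L. L i) (demands n q)) {k<..}"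
    by (simp add: greaterThan_def vimage_def)
  also have "\<dots> = measure_pmf.prob (map_pmf Suc ?G) {k<..}"
    using assms by (simp add: demands_def Pi_pmf_component)
  also have "\<dots> = measure_pmf.prob ?G {k..}"
    by (simp add: greaterThan_def vimage_def less_Suc_eq_le atLeast_def)
  also have "\<dots> = 1 - measure_pmf.prob ?G {..<k}"
    using measure_pmf.prob_compl[of "{..<k}" ?G] by (simp add: Compl_lessThan flip: Compl_eq_Diff_UNIV)
  also have "measure_pmf.prob ?G {..<k} = (\<Sum>j<k. q i ^ j * (1 - q i))"
    using assms by (simp add: measure_measure_pmf_finite)
  also have "\<dots> = 1 - q i ^ k"
    using sum_gp_strict[of "q i" k] assms by (simp flip: sum_distrib_right)
  finally show ?thesis by simp
qed


subsection \<open>Dynamics and objective\<close>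

text \<open>The value at round 0 is a dummy.\<close>

fun active :: "nat \<Rightarrow> policy \<Rightarrow> (nat \<Rightarrow> nat) \<Rightarrow> nat \<Rightarrow> nat set" where
  "active n \<pi> L 0 = {1..n}"
| "active n \<pi> L (Suc 0) = {1..n}"
| "active n \<pi> L (Suc (Suc t)) =
     {i \<in> active n \<pi> L (Suc t). (\<Sum>l=1..Suc t. \<pi> l (active n \<pi> L l) i) < L i}"

definition allocation :: "nat \<Rightarrow> policy \<Rightarrow> (nat \<Rightarrow> nat) \<Rightarrow> nat \<Rightarrow> alloc" where
  "allocation n \<pi> L t = \<pi> t (active n \<pi> L t)"

definition V_EAM :: "nat \<Rightarrow> (nat \<Rightarrow> real) \<Rightarrow> nat \<Rightarrow> policy \<Rightarrow> real" where
  "V_EAM n q \<tau> \<pi> = measure_pmf.expectation (demands n q)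
     (\<lambda>L. real (\<Sum>i=1..n. min (\<Sum>t=1..\<tau>. allocation n \<pi> L t i) (L i)))"


subsection \<open>Fair allocation\<close>

definition fair_for :: "nat \<Rightarrow> nat \<Rightarrow> nat set \<Rightarrow> alloc \<Rightarrow> bool" where
  "fair_for n C M x \<longleftrightarrow>
     (\<Sum>i\<in>M. x i) = C \<and> (\<forall>i\<in>{1..n} - M. x i = 0) \<and>
     (\<forall>i\<in>M. \<forall>j\<in>M. \<bar>int (x i) - int (x j)\<bar> \<in> {0, 1})"

definition fair_policy :: "nat \<Rightarrow> nat \<Rightarrow> policy \<Rightarrow> bool" where
  "fair_policy n C \<pi> \<longleftrightarrow>
     is_policy n C \<pi> \<and>
     (\<forall>t\<ge>1. \<forall>M\<subseteq>{1..n}. M \<noteq> {} \<longrightarrow> fair_for n C M (\<pi> t M))"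


subsection \<open>Greedy effective assignment\<close>

text \<open>An assignment sequence lists, for the effectors in order, the threat each one is given to.\<close>

definition assignment_seq :: "nat \<Rightarrow> nat set \<Rightarrow> nat list \<Rightarrow> bool" where
  "assignment_seq C M s \<longleftrightarrow> length s = C \<and> set s \<subseteq> M"

definition yields :: "nat \<Rightarrow> nat list \<Rightarrow> alloc \<Rightarrow> bool" where
  "yields n s x \<longleftrightarrow> (\<forall>i\<in>{1..n}. x i = count_list s i)"

text \<open>Before the effector with (zero-based) index \<open>k\<close> is assigned, the current allocation is
  \<open>count_list (take k s)\<close>.\<close>

definition greedy_seq :: "(nat \<Rightarrow> real) \<Rightarrow> nat \<Rightarrow> nat set \<Rightarrow> nat list \<Rightarrow> bool" where
  "greedy_seq q C M s \<longleftrightarrow>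
     assignment_seq C M s \<and>
     (\<forall>k<C. is_arg_max (\<lambda>i. q i ^ count_list (take k s) i) (\<lambda>i. i \<in> M) (s ! k))"

definition greedy_policy :: "nat \<Rightarrow> (nat \<Rightarrow> real) \<Rightarrow> nat \<Rightarrow> policy \<Rightarrow> bool" where
  "greedy_policy n q C \<pi> \<longleftrightarrow>
     is_policy n C \<pi> \<and>
     (\<forall>t\<ge>1. \<forall>M\<subseteq>{1..n}. M \<noteq> {} \<longrightarrow> (\<exists>s. greedy_seq q C M s \<and> yields n s (\<pi> t M)))"


subsection \<open>Common tie-breaking\<close>

text \<open>In round \<open>t\<close> with active set \<open>M\<close>, the list \<open>r\<close> is the common order of the active threats.
  The effectors after the first \<open>min C (card M)\<close> are not constrained by it.\<close>

definition same_first_assignments ::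
    "nat \<Rightarrow> (nat \<Rightarrow> real) \<Rightarrow> nat \<Rightarrow> policy \<Rightarrow> policy \<Rightarrow> bool" where
  "same_first_assignments n q C \<pi>EA \<pi>FA \<longleftrightarrow>
     (\<forall>t\<ge>1. \<forall>M\<subseteq>{1..n}. M \<noteq> {} \<longrightarrow>
        (\<exists>r sEA sFA. distinct r \<and> set r = M \<and>
           greedy_seq q C M sEA \<and> yields n sEA (\<pi>EA t M) \<and>
           assignment_seq C M sFA \<and> yields n sFA (\<pi>FA t M) \<and>
           take (min C (card M)) sEA = take (min C (card M)) r \<and>
           take (min C (card M)) sFA = take (min C (card M)) r))"

end

(* Compare a policy with the ideal in which each of the two threats gets the whole capacity in every
   round until it is neutralized.  Once one threat is neutralized the ideal is followed exactly, so
   the loss depends only on the split C = a + b used while both threats are active, and it satisfies a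
   recursion in the number of remaining rounds.  Say u = q 1 <= v = q 2.  If u^a <= v^b, replacing the
   split (a + 1, b) by (a, b + 1) in one round does not increase the loss, provided that all later
   rounds use one of these two splits throughout.  The exchange reduces the loss of the present
   round but makes it more likely that both threats stay active; an induction on the remaining
   rounds shows that the gain outweighs this.  A chain of such exchanges leads from the balanced
   splits to the greedy ones. *)

theory Submission
  imports Defs
begin

section \<open>The loss recursion and its symmetry in the two threats\<close>

text \<open>Both threats are active, \<open>u\<close> and \<open>v\<close> are their failure probabilities, and \<open>b\<close> of the \<open>C\<close>
  effectors go to the second one; \<open>r\<close> rounds follow, and \<open>d\<close> is the loss in them if both threats are
  still active.  By the end, a first threat that gets the whole capacity from the next round on misses
  its effectors \<open>C * r + k\<close> with \<open>C - b \<le> k < C\<close>, each of which is effective with probability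
  \<open>u ^ (C * r + k)\<close>.\<close>

definition round_loss :: "real \<Rightarrow> real \<Rightarrow> nat \<Rightarrow> nat \<Rightarrow> nat \<Rightarrow> real \<Rightarrow> real" where
  "round_loss u v C r b d =
     u ^ (C * r) * (\<Sum>k\<in>{C - b..<C}. u ^ k) + v ^ (C * r) * (\<Sum>k\<in>{b..<C}. v ^ k) +
     u ^ (C - b) * v ^ b * d"

fun loss :: "real \<Rightarrow> real \<Rightarrow> nat \<Rightarrow> (nat \<Rightarrow> nat) \<Rightarrow> nat \<Rightarrow> real" where
  "loss u v C \<beta> 0 = 0"
| "loss u v C \<beta> (Suc r) = round_loss u v C r (\<beta> 0) (loss u v C (\<lambda>s. \<beta> (Suc s)) r)"

lemma round_loss_mono:
  assumes "0 \<le> u" "0 \<le> v" "d \<le> d'"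
  shows "round_loss u v C r b d \<le> round_loss u v C r b d'"
  using assms by (auto simp: round_loss_def intro!: mult_left_mono)

lemma round_loss_swap:
  assumes "b \<le> C"
  shows "round_loss v u C r (C - b) d = round_loss u v C r b d"
  using assms by (simp add: round_loss_def algebra_simps)

lemma loss_swap:
  assumes "\<And>s. \<beta> s \<le> C"
  shows "loss v u C (\<lambda>s. C - \<beta> s) r = loss u v C \<beta> r"
  using assms by (induction r arbitrary: \<beta>) (simp_all add: round_loss_swap)

section \<open>Power sums and the exchange of one effector\<close>

lemma sum_power_add:
  fixes x :: real
  shows "(\<Sum>k\<in>{a + b..<a + c}. x ^ k) = x ^ a * (\<Sum>k\<in>{b..<c}. x ^ k)"
  using sum.shift_bounds_nat_ivl[of "\<lambda>k. x ^ k" b a c]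
  by (simp add: power_add sum_distrib_left mult.commute add.commute)

text \<open>In the factorization of \<open>v ^ A - u ^ A\<close> with cofactor
  \<open>\<Sum>k<A. u ^ (A - Suc k) * v ^ k\<close>, every exponent of \<open>u\<close> is at most
  \<open>a\<close>, so each such power is at least \<open>u ^ a\<close>.\<close>

lemma power_diff_ge_larger:
  fixes u v :: real
  assumes "0 \<le> u" "u \<le> v" "u \<le> 1" "A \<le> Suc a"
  shows "u ^ a * (v - u) * (\<Sum>k<A. v ^ k) \<le> v ^ A - u ^ A"
proof -
  have "u ^ a * (\<Sum>k<A. v ^ k) \<le> (\<Sum>k<A. u ^ (A - Suc k) * v ^ k)"
    unfolding sum_distrib_left using assms
    by (intro sum_mono mult_right_mono power_decreasing) auto
  then have "(v - u) * (u ^ a * (\<Sum>k<A. v ^ k)) \<le> (v - u) * (\<Sum>k<A. u ^ (A - Suc k) * v ^ k)"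
    using assms by (intro mult_left_mono) auto
  also have "\<dots> = v ^ A - u ^ A" by (simp add: power_diff_sumr2)
  finally show ?thesis by (simp add: algebra_simps)
qed

lemma power_diff_ge_smaller:
  fixes u v :: real
  assumes "0 \<le> u" "u \<le> v" "v \<le> 1" "B \<le> Suc b"
  shows "v ^ b * (v - u) * (\<Sum>k<B. u ^ k) \<le> v ^ B - u ^ B"
proof -
  have "v ^ b * (\<Sum>k<B. u ^ k) \<le> (\<Sum>k<B. v ^ (B - Suc k) * u ^ k)"
    unfolding sum_distrib_left using assms
    by (intro sum_mono mult_right_mono power_decreasing) auto
  then have "(v - u) * (v ^ b * (\<Sum>k<B. u ^ k)) \<le> (v - u) * (\<Sum>k<B. v ^ (B - Suc k) * u ^ k)"
    using assms by (intro mult_left_mono) auto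
  also have "\<dots> = v ^ B - u ^ B"
    using power_diff_sumr2[of u B v] by (simp add: algebra_simps)
  finally show ?thesis by (simp add: algebra_simps)
qed

text \<open>The left side is what the increased chance of both threats staying active costs later,
  the right side what the exchange saves in the present round; see \<open>round_loss_diff\<close>.
  At \<open>r = 0\<close> this is \<open>le\<close>.\<close>

lemma exchange_gain:
  fixes u v :: real
  assumes uv: "0 \<le> u" "u \<le> v" "v \<le> 1" and ab: "a + b + 1 = C" and le: "u ^ a \<le> v ^ b"
    and B: "B \<le> C" "C - B \<le> Suc a" "B \<le> Suc b"
  shows "u ^ a * v ^ b * (v - u) * loss u v C (\<lambda>_. B) r \<le> v ^ b * v ^ (C * r) - u ^ a * u ^ (C * r)"
proof (induction r)
  case 0
  then show ?case using le by simp
next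
  case (Suc r)
  define A where "A = C - B"
  have C: "C = A + B" and A: "A \<le> Suc a" using B by (auto simp: A_def)
  define D where "D = loss u v C (\<lambda>_. B) r"
  define S where "S = (\<Sum>k<B. u ^ k)"
  define T where "T = (\<Sum>k<A. v ^ k)"
  have 1: "(\<Sum>k\<in>{A..<C}. u ^ k) = u ^ A * S" "(\<Sum>k\<in>{B..<C}. v ^ k) = v ^ B * T"
    unfolding S_def T_def using sum_power_add[of u A 0 B] sum_power_add[of v B 0 A]
    by (simp_all add: C atLeast0LessThan add.commute)
  have loss: "loss u v C (\<lambda>_. B) (Suc r) =
      u ^ (C * r) * (u ^ A * S) + v ^ (C * r) * (v ^ B * T) + u ^ A * v ^ B * D"
    by (simp add: round_loss_def 1 D_def flip: A_def)
  have v: "0 \<le> v" "u \<le> 1" using uv by auto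
  have "u ^ a * (v - u) * T \<le> v ^ A - u ^ A" unfolding T_def
    using uv A by (intro power_diff_ge_larger) auto
  \<comment> \<open>The weights in \<open>t\<close>, \<open>s\<close> and \<open>d\<close> complete
    the coefficients of \<open>T\<close>, \<open>S\<close> and \<open>D\<close> in the goal. The
    three right sides then telescope to the required difference.\<close>
  then have t: "(v ^ (C * r) * v ^ b * v ^ B) * (u ^ a * (v - u) * T)
      \<le> (v ^ (C * r) * v ^ b * v ^ B) * (v ^ A - u ^ A)"
    using v by (intro mult_left_mono) auto
  have "v ^ b * (v - u) * S \<le> v ^ B - u ^ B" unfolding S_def
    using uv B by (intro power_diff_ge_smaller) auto
  then have s: "(u ^ (C * r) * u ^ a * u ^ A) * (v ^ b * (v - u) * S)
      \<le> (u ^ (C * r) * u ^ a * u ^ A) * (v ^ B - u ^ B)"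
    using uv by (intro mult_left_mono) auto
  have d: "(u ^ A * v ^ B) * (u ^ a * v ^ b * (v - u) * D)
      \<le> (u ^ A * v ^ B) * (v ^ b * v ^ (C * r) - u ^ a * u ^ (C * r))"
    using Suc uv v unfolding D_def by (intro mult_left_mono) auto
  have p: "x ^ (C * Suc r) = x ^ (C * r) * x ^ A * x ^ B" for x :: real
    by (simp add: C power_add algebra_simps)
  show ?case
    unfolding loss p using t s d by (simp add: algebra_simps)
qed

text \<open>Only the boundary terms \<open>u ^ a\<close> and \<open>v ^ b\<close> of the two sums
  change, and the probability that both threats stay active changes by
  \<open>u ^ a * v ^ b * (v - u)\<close>.\<close>

lemma round_loss_diff:
  assumes "a + b + 1 = C"
  shows "round_loss u v C r b d - round_loss u v C r (Suc b) d =
    v ^ b * v ^ (C * r) - u ^ a * u ^ (C * r) - u ^ a * v ^ b * (v - u) * d"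
proof -
  have "C - b = Suc a" "C - Suc b = a" "b < C" "a < C" using assms by auto
  then show ?thesis
    by (simp add: round_loss_def sum.atLeast_Suc_lessThan[of b C] sum.atLeast_Suc_lessThan[of a C]
        algebra_simps)
qed

text \<open>\<open>b\<close> and \<open>Suc b\<close> are exactly the values of \<open>B\<close>
  that the bounds in \<open>exchange_gain\<close> admit.\<close>

lemma round_loss_exchange:
  fixes u v :: real
  assumes "0 \<le> u" "u \<le> v" "v \<le> 1" "b < C" "u ^ (C - Suc b) \<le> v ^ b" "B = b \<or> B = Suc b"
  shows "round_loss u v C r (Suc b) (loss u v C (\<lambda>_. B) r) \<le> round_loss u v C r b (loss u v C (\<lambda>_. B) r)"
proof -
  have "C - Suc b + b + 1 = C" "B \<le> C" "C - B \<le> Suc (C - Suc b)" "B \<le> Suc b"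
    using assms by auto
  then show ?thesis
    using exchange_gain[of u v "C - Suc b" b C B r] assms
      round_loss_diff[of "C - Suc b" b C u v r "loss u v C (\<lambda>_. B) r"]
    by linarith
qed

lemma loss_const_le:
  fixes u v :: real
  assumes "0 \<le> u" "u \<le> v" "v \<le> 1" "b < C" "u ^ (C - Suc b) \<le> v ^ b"
  shows "loss u v C (\<lambda>_. Suc b) r \<le> loss u v C (\<lambda>_. b) r"
proof (induction r)
  case (Suc r)
  then have "round_loss u v C r (Suc b) (loss u v C (\<lambda>_. Suc b) r) \<le>
    round_loss u v C r (Suc b) (loss u v C (\<lambda>_. b) r)"
    using assms by (intro round_loss_mono) auto
  also have "\<dots> \<le> round_loss u v C r b (loss u v C (\<lambda>_. b) r)"
    using assms by (intro round_loss_exchange) auto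
  finally show ?case by simp
qed auto

section \<open>Local optimality, and the case of equal failure probabilities\<close>

text \<open>All that is used of the greedy rule: no effector should rather have gone to the other threat.\<close>

definition locally_optimal :: "real \<Rightarrow> real \<Rightarrow> nat \<Rightarrow> nat \<Rightarrow> bool" where
  "locally_optimal u v C b \<longleftrightarrow> b \<le> C \<and>
     (0 < b \<longrightarrow> u ^ (C - b) \<le> v ^ (b - 1)) \<and> (b < C \<longrightarrow> v ^ b \<le> u ^ (C - Suc b))"

text \<open>Lowering \<open>k\<close> raises the exponent of \<open>u\<close> and lowers that of
  \<open>v\<close>, so the condition at \<open>b - 1\<close> passes down: every exchange on the way
  up to \<open>b\<close> is admissible.\<close>

lemma exchange_condition:
  assumes "0 \<le> u" "u \<le> (1::real)" "0 \<le> v" "v \<le> 1" "locally_optimal u v C b" "k < b"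
  shows "u ^ (C - Suc k) \<le> v ^ k"
proof -
  have "u ^ (C - Suc k) \<le> u ^ (C - b)" using assms by (intro power_decreasing) auto
  also have "\<dots> \<le> v ^ (b - 1)" using assms by (auto simp: locally_optimal_def)
  also have "\<dots> \<le> v ^ k" using assms by (intro power_decreasing) auto
  finally show ?thesis .
qed

lemma locally_optimal_swap:
  "locally_optimal u v C b \<Longrightarrow> locally_optimal v u C (C - b)"
  by (auto simp: locally_optimal_def)

text \<open>For equal probabilities the term with \<open>d\<close> in \<open>round_loss_diff\<close>
  vanishes, so an exchange helps whatever happens in later rounds.\<close>

lemma round_loss_eq_prob_le_below:
  fixes u :: real
  assumes u: "0 \<le> u" "u \<le> 1" and opt: "locally_optimal u u C b" and "k \<le> b"
  shows "round_loss u u C r b d \<le> round_loss u u C r k d"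
  using \<open>k \<le> b\<close>
proof (induction k rule: inc_induct)
  case (step k)
  have "u ^ (C - Suc k) \<le> u ^ k" using exchange_condition[OF u u opt] step by auto
  then have "u ^ (C - Suc k) * u ^ (C * r) \<le> u ^ k * u ^ (C * r)"
    using u by (intro mult_right_mono) auto
  moreover have "C - Suc k + k + 1 = C" using step opt by (auto simp: locally_optimal_def)
  ultimately have "round_loss u u C r (Suc k) d \<le> round_loss u u C r k d"
    using round_loss_diff[of "C - Suc k" k C u u r d] by simp
  then show ?case using step.IH by (rule order_trans[rotated])
qed auto

lemma round_loss_eq_prob_le:
  fixes u :: real
  assumes u: "0 \<le> u" "u \<le> 1" and opt: "locally_optimal u u C b" and "k \<le> C"
  shows "round_loss u u C r b d \<le> round_loss u u C r k d"
proof (cases "k \<le> b")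
  case True
  then show ?thesis by (rule round_loss_eq_prob_le_below[OF u opt])
next
  case False
  \<comment> \<open>Renaming the threats turns \<open>k > b\<close> into the previous case.\<close>
  then have "round_loss u u C r (C - b) d \<le> round_loss u u C r (C - k) d"
    by (intro round_loss_eq_prob_le_below[OF u locally_optimal_swap[OF opt]]) auto
  then show ?thesis using opt \<open>k \<le> C\<close>
    by (simp only: round_loss_swap locally_optimal_def)
qed

lemma loss_eq_prob_le:
  fixes u :: real
  assumes "0 \<le> u" "u \<le> 1" "\<And>s. locally_optimal u u C (\<gamma> s)" "\<And>s. \<phi> s \<le> C"
  shows "loss u u C \<gamma> r \<le> loss u u C \<phi> r"
  using assms(3,4)
proof (induction r arbitrary: \<gamma> \<phi>)
  case (Suc r)
  have "loss u u C (\<lambda>s. \<gamma> (Suc s)) r \<le> loss u u C (\<lambda>s. \<phi> (Suc s)) r"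
    by (intro Suc.IH Suc.prems)
  then have "round_loss u u C r (\<gamma> 0) (loss u u C (\<lambda>s. \<gamma> (Suc s)) r) \<le>
      round_loss u u C r (\<gamma> 0) (loss u u C (\<lambda>s. \<phi> (Suc s)) r)"
    using assms by (intro round_loss_mono) auto
  also have "\<dots> \<le> round_loss u u C r (\<phi> 0) (loss u u C (\<lambda>s. \<phi> (Suc s)) r)"
    using assms Suc.prems by (intro round_loss_eq_prob_le) auto
  finally show ?case by simp
qed auto

section \<open>Greedy splits against balanced splits\<close>

text \<open>Ties in the greedy rule leave two adjacent choices.\<close>

lemma locally_optimal_adjacent:
  fixes u v :: real
  assumes "0 \<le> u" "u < v" "v < 1" "locally_optimal u v C b" "locally_optimal u v C c" "b \<le> c"
  shows "c \<le> Suc b"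
proof (rule ccontr)
  assume "\<not> c \<le> Suc b"
  have C: "c \<le> C" using assms by (auto simp: locally_optimal_def)
  \<comment> \<open>With \<open>c \<ge> b + 2\<close> the two optimality conditions close the cycle
    \<open>v ^ b \<le> u ^ (C - Suc b) \<le> u ^ (C - c) \<le> v ^ (c - 1) \<le> v * v ^ b < v ^
    b\<close>.\<close>
  have "v * v ^ b \<ge> v ^ (c - 1)"
    using assms \<open>\<not> c \<le> Suc b\<close> power_decreasing[of "Suc b" "c - 1" v] by auto
  moreover have "u ^ (C - c) \<le> v ^ (c - 1)" using assms \<open>\<not> c \<le> Suc b\<close> by (auto simp: locally_optimal_def)
  moreover have "v ^ b \<le> u ^ (C - Suc b)" using assms \<open>\<not> c \<le> Suc b\<close> C by (auto simp: locally_optimal_def)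
  moreover have "u ^ (C - Suc b) \<le> u ^ (C - c)" using assms \<open>\<not> c \<le> Suc b\<close> by (intro power_decreasing) auto
  moreover have "v * v ^ b < v ^ b" using assms by simp
  ultimately show False by linarith
qed

lemma locally_optimal_ge_half:
  fixes u v :: real
  assumes "0 \<le> u" "u < v" "v < 1" "2 \<le> C" "locally_optimal u v C b"
  shows "C - C div 2 \<le> b"
proof (rule ccontr)
  assume "\<not> C - C div 2 \<le> b"
  then have b: "b \<le> C - Suc b" "b < C" by auto
  have 1: "v ^ b \<le> u ^ (C - Suc b)" using assms b by (auto simp: locally_optimal_def)
  show False
  \<comment> \<open>At \<open>b = 0\<close> the strict comparison of \<open>u ^ b\<close> with
    \<open>v ^ b\<close> fails; there \<open>2 \<le> C\<close> gives
    \<open>u ^ (C - 1) < 1\<close>.\<close>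
  proof (cases "b = 0")
    case True
    then show False using 1 assms power_less_one_iff[of u "C - 1"] by auto
  next
    case False
    have "u ^ (C - Suc b) \<le> u ^ b" using assms b by (intro power_decreasing) auto
    also have "\<dots> < v ^ b" using assms False by (intro power_strict_mono) auto
    finally show False using 1 by simp
  qed
qed

text \<open>Exchanges are available only before a constant continuation. The chain therefore runs
  through two constant splits: the least greedy one \<open>k\<close> and the larger balanced one
  \<open>h\<close>.\<close>

lemma loss_locally_optimal_le_balanced:
  fixes u v :: real
  assumes u: "0 \<le> u" and uv: "u \<le> v" and v: "v < 1" and C: "2 \<le> C"
    and opt: "\<And>s. locally_optimal u v C (\<gamma> s)"
    and bal: "\<And>s. \<phi> s = C div 2 \<or> \<phi> s = C - C div 2"
  shows "loss u v C \<gamma> r \<le> loss u v C \<phi> r"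
proof (cases "u = v")
  case True
  have "\<phi> s \<le> C" for s using bal[of s] by auto
  then show ?thesis using True assms loss_eq_prob_le[of u C \<gamma> \<phi> r] by auto
next
  case False
  then have uv': "u < v" using uv by auto
  \<comment> \<open>Ties may be broken differently in each round; relative to the least split,
    adjacency leaves only \<open>k\<close> and \<open>Suc k\<close>.\<close>
  obtain s0 where min: "\<And>s. \<gamma> s0 \<le> \<gamma> s"
    using ex_has_least_nat[of "\<lambda>_. True" _ \<gamma>] by auto
  define k where "k = \<gamma> s0"
  have ko: "locally_optimal u v C k" and "k \<le> C" using opt[of s0] by (auto simp: k_def locally_optimal_def)
  have \<gamma>: "\<gamma> s = k \<or> \<gamma> s = Suc k" for s
    using locally_optimal_adjacent[OF u uv' v ko opt[of s]] min[of s] by (auto simp: k_def)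
  define h where "h = C - C div 2"
  have "loss u v C \<gamma> r \<le> loss u v C (\<lambda>_. k) r"
    using \<gamma> opt
  proof (induction r arbitrary: \<gamma>)
    case (Suc r)
    have "round_loss u v C r (\<gamma> 0) (loss u v C (\<lambda>s. \<gamma> (Suc s)) r) \<le>
      round_loss u v C r (\<gamma> 0) (loss u v C (\<lambda>_. k) r)"
      using Suc u uv v by (intro round_loss_mono) auto
    also have "\<dots> \<le> round_loss u v C r k (loss u v C (\<lambda>_. k) r)"
    proof (cases "\<gamma> 0 = k")
      case False
      then have "\<gamma> 0 = Suc k" using Suc.prems by auto
      moreover have "u ^ (C - Suc k) \<le> v ^ k" "k < C"
        using exchange_condition[of u v C "\<gamma> 0" k] Suc.prems(2)[of 0] u uv v \<open>\<gamma> 0 = Suc k\<close>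
        by (auto simp: locally_optimal_def)
      ultimately show ?thesis using u uv v round_loss_exchange[of u v k C k r] by auto
    qed auto
    finally show ?case by simp
  qed auto
  also have "loss u v C (\<lambda>_. k) r \<le> loss u v C (\<lambda>_. h) r"
  proof -
    have "h \<le> k" unfolding h_def using locally_optimal_ge_half[OF u uv' v C ko] .
    then show ?thesis
    proof (induction h rule: inc_induct)
      case (step j)
      have "u ^ (C - Suc j) \<le> v ^ j"
        using exchange_condition[OF _ _ _ _ ko] step u uv v by auto
      then show ?case using step loss_const_le[of u v j C r] u uv v \<open>k \<le> C\<close> by fastforce
    qed auto
  qed
  also have "loss u v C (\<lambda>_. h) r \<le> loss u v C \<phi> r"
    using bal
  proof (induction r arbitrary: \<phi>)
    case (Suc r)
    have "round_loss u v C r h (loss u v C (\<lambda>_. h) r) \<le>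
      round_loss u v C r (\<phi> 0) (loss u v C (\<lambda>_. h) r)"
    proof (cases "\<phi> 0 = h")
      case False
      \<comment> \<open>This happens only for odd \<open>C\<close>; the remaining effectors then
        split evenly, and the exchange condition is just monotonicity of the power.\<close>
      then have 1: "h = Suc (\<phi> 0)" "C - Suc (\<phi> 0) = \<phi> 0" "\<phi> 0 < C"
        using Suc.prems[of 0] by (auto simp: h_def)
      then show ?thesis
        using round_loss_exchange[of u v "\<phi> 0" C h r] u uv v power_mono[OF uv u, of "\<phi> 0"] by auto
    qed auto
    also have "\<dots> \<le> round_loss u v C r (\<phi> 0) (loss u v C (\<lambda>s. \<phi> (Suc s)) r)"
      using Suc u uv v by (intro round_loss_mono) auto
    finally show ?case by simp
  qed auto
  finally show ?thesis .
qed

section \<open>Two independent geometric demands\<close>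

lemma atLeastAtMost_1_2: "{1..2::nat} = {1, 2}" by auto

lemma prob_demands_2:
  assumes "\<And>i. i \<in> {1..2} \<Longrightarrow> 0 \<le> q i \<and> q i < 1"
  shows "measure_pmf.prob (demands 2 q) {L. j < L 1 \<and> k < L 2} = q 1 ^ j * q 2 ^ k"
proof -
  define m where "m = (\<lambda>i::nat. if i = 1 then j else k)"
  define G where "G = (\<lambda>i. map_pmf Suc (geometric_pmf (1 - q i)))"
  have geo: "measure_pmf.prob (G i) {l. m i < l} = q i ^ m i"
    if "i \<in> {1..2}" for i
  proof -
    have "measure_pmf.prob (demands 2 q) {L. L i > m i} =
      measure_pmf.prob (map_pmf (\<lambda>L. L i) (demands 2 q)) {l. m i < l}"
      by (simp add: vimage_def)
    also have "\<dots> = measure_pmf.prob (G i) {l. m i < l}"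
      using that by (simp add: demands_def Pi_pmf_component G_def)
    finally show ?thesis using prob_demands_gt[of i 2 q "m i"] that assms by simp
  qed
  have "{L. j < L 1 \<and> k < L 2} = Pi {1..2} (\<lambda>i. {l. m i < l})"
    unfolding atLeastAtMost_1_2 by (auto simp: m_def Pi_def)
  then have "measure_pmf.prob (demands 2 q) {L. j < L 1 \<and> k < L 2} = (\<Prod>i\<in>{1..2}. q i ^ m i)"
    unfolding demands_def G_def[symmetric] by (simp only: measure_Pi_pmf_Pi finite_atLeastAtMost)
      (intro prod.cong refl geo)
  then show ?thesis unfolding atLeastAtMost_1_2 by (simp add: m_def)
qed

lemma expectation_demands_2:
  assumes "\<And>i. i \<in> {1..2} \<Longrightarrow> 0 \<le> q i \<and> q i < 1"
  shows "measure_pmf.expectation (demands 2 q) (\<lambda>L. of_bool (j < L 1 \<and> k < L 2)) = q 1 ^ j * q 2 ^ k"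
proof -
  have "(\<lambda>L::nat\<Rightarrow>nat. of_bool (j < L 1 \<and> k < L 2) :: real) = indicator {L. j < L 1 \<and> k < L 2}"
    by (auto simp: indicator_def)
  then show ?thesis using prob_demands_2[OF assms] by simp
qed

lemma demands_pos:
  assumes "L \<in> set_pmf (demands n q)" "i \<in> {1..n}"
  shows "0 < L i"
  using assms by (auto simp: demands_def set_Pi_pmf PiE_dflt_def)

text \<open>Cumulative allocations never decrease, so the latest test subsumes all earlier ones.
  Positive demands settle the first round.\<close>

lemma active_conv_allocated:
  assumes "\<And>i. i \<in> {1..n} \<Longrightarrow> 0 < L i"
  shows "active n \<pi> L (Suc t) = {i \<in> {1..n}. (\<Sum>l=1..t. allocation n \<pi> L l i) < L i}"
proof (induction t)
  case (Suc t)
  show ?case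
    unfolding active.simps(3) Suc by (auto simp: allocation_def)
qed (use assms in auto)

lemma min_eq_sum_of_bool: "real (min m l) = (\<Sum>k<m. of_bool (k < l))"
proof -
  have "(\<Sum>k<m. of_bool (k < l)) = real (card ({..<m} \<inter> {k. k < l}))"
    by (simp add: sum_of_bool_eq)
  also have "{..<m} \<inter> {k. k < l} = {..<min m l}" by auto
  finally show ?thesis by simp
qed

lemma min_diff_eq_sum_of_bool:
  assumes "a \<le> b"
  shows "real (min b l) - real (min a l) = (\<Sum>k\<in>{a..<b}. of_bool (k < l))"
proof -
  have "(\<Sum>k<b. of_bool (k < l)) = (\<Sum>k<a. of_bool (k < l)) + (\<Sum>k\<in>{a..<b}. of_bool (k < l) :: real)"
    using sum.atLeastLessThan_concat[of 0 a b "\<lambda>k. of_bool (k < l) :: real"] assms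
    by (simp only: atLeast0LessThan)
  then show ?thesis by (simp add: min_eq_sum_of_bool)
qed

section \<open>Effectors received, as the ideal minus a shortfall\<close>

text \<open>What a threat of demand \<open>l\<close> would have received after \<open>t\<close> rounds if it got the whole capacity in
  every round that does not start with both threats active.  It agrees with what the threat really
  received up to truncation at \<open>l\<close>, but is easier to sum up.\<close>

definition potential :: "nat \<Rightarrow> (nat \<Rightarrow> nat) \<Rightarrow> (nat \<Rightarrow> nat) \<Rightarrow> nat \<Rightarrow> nat \<Rightarrow> nat \<Rightarrow> nat" where
  "potential C \<alpha> \<beta> l m t =
     (\<Sum>s<t. if (\<Sum>r<s. \<alpha> r) < l \<and> (\<Sum>r<s. \<beta> r) < m then \<alpha> s else C)"

lemma potential_both:
  assumes "(\<Sum>r<t. \<alpha> r) < l" "(\<Sum>r<t. \<beta> r) < m"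
  shows "potential C \<alpha> \<beta> l m t = (\<Sum>r<t. \<alpha> r)"
  unfolding potential_def
proof (intro sum.cong refl)
  fix s assume "s \<in> {..<t}"
  then have "(\<Sum>r<s. \<alpha> r) \<le> (\<Sum>r<t. \<alpha> r)" "(\<Sum>r<s. \<beta> r) \<le> (\<Sum>r<t. \<beta> r)"
    by (auto intro!: sum_mono2)
  then show "(if (\<Sum>r<s. \<alpha> r) < l \<and> (\<Sum>r<s. \<beta> r) < m then \<alpha> s else C) = \<alpha> s"
    using assms by auto
qed

text \<open>Switching to full capacity after \<open>t\<close> rounds interpolates between the ideal
  at \<open>t = 0\<close> and the policy at \<open>t = \<tau>\<close>. Each further round followed
  removes one interval of effectors.\<close>

lemma min_potential:
  assumes "\<And>s. \<alpha> s \<le> C" "t \<le> \<tau>"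
  shows "real (min (potential C \<alpha> \<beta> l m t + C * (\<tau> - t)) l) =
    (\<Sum>k<C*\<tau>. of_bool (k < l)) -
    (\<Sum>s<t. \<Sum>k\<in>{(\<Sum>r<Suc s. \<alpha> r) + C * (\<tau> - Suc s)..<(\<Sum>r<s. \<alpha> r) + C * (\<tau> - s)}.
       of_bool (k < l \<and> (\<Sum>r<s. \<beta> r) < m))"
  using \<open>t \<le> \<tau>\<close>
proof (induction t)
  case 0
  then show ?case by (simp add: potential_def min_eq_sum_of_bool)
next
  case (Suc t)
  define A where "A = (\<lambda>t. \<Sum>r<t. \<alpha> r)"
  define B where "B = (\<Sum>r<t. \<beta> r)"
  obtain d where \<tau>: "\<tau> = Suc t + d" using Suc.prems le_Suc_ex by blast
  define I where "I = (\<Sum>k\<in>{A (Suc t) + C * d..<A t + C * Suc d}. of_bool (k < l \<and> B < m) :: real)"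
  have ASuc: "A (Suc t) = A t + \<alpha> t" by (simp add: A_def)
  have pSuc: "potential C \<alpha> \<beta> l m (Suc t) = potential C \<alpha> \<beta> l m t + (if A t < l \<and> B < m then \<alpha> t else C)"
    by (simp add: potential_def A_def B_def)
  have "real (min (potential C \<alpha> \<beta> l m (Suc t) + C * d) l) =
    real (min (potential C \<alpha> \<beta> l m t + C * Suc d) l) - I"
  proof (cases "A t < l \<and> B < m")
    case True
    have "potential C \<alpha> \<beta> l m t = A t"
      using True potential_both[where \<alpha>=\<alpha> and \<beta>=\<beta>] by (simp add: A_def B_def)
    moreover have "I = real (min (A t + C * Suc d) l) - real (min (A (Suc t) + C * d) l)"
      using True assms(1)[of t] unfolding I_def ASuc by (subst min_diff_eq_sum_of_bool) auto
    ultimately show ?thesis using True by (simp add: pSuc ASuc)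
  next
    case False
    \<comment> \<open>Either \<open>B < m\<close> fails, or every \<open>k\<close> in the interval
      is at least \<open>A t\<close>, hence at least \<open>l\<close>.\<close>
    then have "I = 0" unfolding I_def ASuc by (intro sum.neutral) auto
    then show ?thesis using False by (auto simp: pSuc algebra_simps)
  qed
  then show ?case using Suc.IH by (simp add: I_def A_def B_def \<tau>)
qed

lemma policy_sum_both:
  assumes "is_policy 2 C \<pi>" "1 \<le> t"
  shows "\<pi> t {1, 2} 1 + \<pi> t {1, 2} 2 = C"
proof -
  have "(\<Sum>i\<in>{1, 2}. \<pi> t {1, 2} i) = C"
    using assms unfolding is_policy_def by (metis atLeastAtMost_singleton_iff insert_not_empty
        order_refl atLeastAtMost_1_2)
  then show ?thesis by simp
qed

lemma allocated_eq_potential: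
  fixes \<pi> :: policy and L :: "nat \<Rightarrow> nat"
  assumes pol: "is_policy 2 C \<pi>" and pos: "0 < L 1" "0 < L 2"
    and ij: "{i, j} = {1, 2}"
  defines "X \<equiv> \<lambda>i t. \<Sum>s=1..t. allocation 2 \<pi> L s i"
  defines "Z \<equiv> \<lambda>i j t. potential C (\<lambda>s. \<pi> (Suc s) {1, 2} i) (\<lambda>s. \<pi> (Suc s) {1, 2} j) (L i) (L j) t"
  shows "min (X i t) (L i) = min (Z i j t) (L i)"
proof -
  have sums: "\<pi> (Suc t) {k} k = C" if "k \<in> {1,2}" for t k
  proof -
    have "(\<Sum>i\<in>{k}. \<pi> (Suc t) {k} i) = C"
      using pol that unfolding is_policy_def atLeastAtMost_1_2 by (metis Suc_leI zero_less_Suc One_nat_def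
          empty_subsetI insert_not_empty insert_subset)
    then show ?thesis by simp
  qed
  define A where "A = (\<lambda>i t. \<Sum>s<t. \<pi> (Suc s) {1, 2} i)"
  have act: "active 2 \<pi> L (Suc t) = {k \<in> {1, 2}. X k t < L k}" for t
    using active_conv_allocated[of 2 L \<pi> t] pos unfolding X_def atLeastAtMost_1_2 by auto
  have XSuc: "X k (Suc t) = X k t + \<pi> (Suc t) {k \<in> {1, 2}. X k t < L k} k" for k t
    by (simp add: X_def allocation_def act del: active.simps)
  have ZSuc: "Z i j (Suc t) = Z i j t + (if A i t < L i \<and> A j t < L j then \<pi> (Suc t) {1, 2} i else C)" for i j t
    by (simp add: Z_def potential_def A_def)
  have ASuc: "A k (Suc t) = A k t + \<pi> (Suc t) {1, 2} k" for k t by (simp add: A_def)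
  have Zboth: "Z i j t = A i t" if "A i t < L i" "A j t < L j" for i j t
    using that unfolding A_def Z_def by (rule potential_both)
  \<comment> \<open>The active set depends on both threats, so both are tracked in one induction.
    Exact equality is claimed only below the demand, since the two counts may differ
    afterwards.\<close>
  have "((X 1 t < L 1 \<and> X 2 t < L 2) \<longleftrightarrow> (A 1 t < L 1 \<and> A 2 t < L 2)) \<and>
    (X 1 t < L 1 \<longleftrightarrow> Z 1 2 t < L 1) \<and> (X 1 t < L 1 \<longrightarrow> X 1 t = Z 1 2 t) \<and>
    (X 2 t < L 2 \<longleftrightarrow> Z 2 1 t < L 2) \<and> (X 2 t < L 2 \<longrightarrow> X 2 t = Z 2 1 t)"
  proof (induction t)
    case 0
    then show ?case by (simp add: X_def A_def Z_def potential_def)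
  next
    case (Suc t)
    consider "X 1 t < L 1" "X 2 t < L 2" | "X 1 t < L 1" "\<not> X 2 t < L 2"
      | "\<not> X 1 t < L 1" "X 2 t < L 2" | "\<not> X 1 t < L 1" "\<not> X 2 t < L 2" by blast
    then show ?case
    proof cases
      case 1
      then have a: "A 1 t < L 1 \<and> A 2 t < L 2" using Suc by blast
      have s: "{k \<in> {1, 2}. X k t < L k} = {1, 2}" using 1 by auto
      have X: "X 1 t = A 1 t" "X 2 t = A 2 t" using Zboth[of 1 t 2] Zboth[of 2 t 1] a 1 Suc by auto
      show ?thesis unfolding XSuc ZSuc ASuc s using a Zboth[of 1 t 2] Zboth[of 2 t 1] X by auto
    next
      case 2
      then have a: "\<not> (A 1 t < L 1 \<and> A 2 t < L 2)" using Suc by blast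
      have s: "{k \<in> {1, 2}. X k t < L k} = {1}" using 2 by auto
      show ?thesis unfolding XSuc ZSuc ASuc s using a 2 Suc sums[of 1 t] by auto
    next
      case 3
      then have a: "\<not> (A 1 t < L 1 \<and> A 2 t < L 2)" using Suc by blast
      have s: "{k \<in> {1, 2}. X k t < L k} = {2}" using 3 by auto
      show ?thesis unfolding XSuc ZSuc ASuc s using a 3 Suc sums[of 2 t] by auto
    next
      case 4
      then have a: "\<not> (A 1 t < L 1 \<and> A 2 t < L 2)" using Suc by blast
      show ?thesis unfolding XSuc ZSuc ASuc using a 4 Suc by auto
    qed
  qed
  moreover have "i = 1 \<and> j = 2 \<or> i = 2 \<and> j = 1" using ij by (auto simp: doubleton_eq_iff)
  ultimately show ?thesis by (auto simp: min_def)
qed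

section \<open>The value of a policy as the ideal minus its loss\<close>

text \<open>The expectation of the double sum in \<open>min_potential\<close> for \<open>t = \<tau>\<close>.\<close>

definition survivor_loss :: "nat \<Rightarrow> nat \<Rightarrow> (nat \<Rightarrow> nat) \<Rightarrow> (nat \<Rightarrow> nat) \<Rightarrow> real \<Rightarrow> real \<Rightarrow> real" where
  "survivor_loss C \<tau> \<alpha> \<beta> u v =
    (\<Sum>s<\<tau>. \<Sum>k\<in>{(\<Sum>r<Suc s. \<alpha> r) + C * (\<tau> - Suc s)..<(\<Sum>r<s. \<alpha> r) + C * (\<tau> - s)}.
       u ^ k * v ^ (\<Sum>r<s. \<beta> r))"

text \<open>Peeling off the first round shifts all later intervals by \<open>\<alpha> 0\<close> and
  the exponents of \<open>v\<close> by \<open>\<beta> 0\<close>; this recursion matches that of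
  \<open>loss\<close>.\<close>

lemma survivor_loss_Suc:
  "survivor_loss C (Suc \<tau>) \<alpha> \<beta> u v =
     u ^ (C * \<tau>) * (\<Sum>k\<in>{\<alpha> 0..<C}. u ^ k) +
     u ^ \<alpha> 0 * v ^ \<beta> 0 * survivor_loss C \<tau> (\<lambda>s. \<alpha> (Suc s)) (\<lambda>s. \<beta> (Suc s)) u v"
proof -
  have split: "(\<Sum>r<Suc s. f r) = f 0 + (\<Sum>r<s. f (Suc r))" for f :: "nat \<Rightarrow> nat" and s
    by (rule sum.lessThan_Suc_shift)
  have "survivor_loss C (Suc \<tau>) \<alpha> \<beta> u v =
    (\<Sum>k\<in>{C * \<tau> + \<alpha> 0..<C * \<tau> + C}. u ^ k) +
    (\<Sum>s<\<tau>. \<Sum>k\<in>{\<alpha> 0 + ((\<Sum>r<Suc s. \<alpha> (Suc r)) + C * (\<tau> - Suc s))..<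
                   \<alpha> 0 + ((\<Sum>r<s. \<alpha> (Suc r)) + C * (\<tau> - s))}. u ^ k * v ^ (\<beta> 0 + (\<Sum>r<s. \<beta> (Suc r))))"
    unfolding survivor_loss_def sum.lessThan_Suc_shift[of _ \<tau>] split[of \<alpha>] split[of \<beta>]
    by (simp add: add.assoc add.commute[of _ "C * \<tau>"] add.commute[of C])
  also have "\<dots> = u ^ (C * \<tau>) * (\<Sum>k\<in>{\<alpha> 0..<C}. u ^ k) +
     u ^ \<alpha> 0 * v ^ \<beta> 0 * survivor_loss C \<tau> (\<lambda>s. \<alpha> (Suc s)) (\<lambda>s. \<beta> (Suc s)) u v"
    unfolding survivor_loss_def sum_distrib_right[symmetric] sum_power_add
    by (simp add: power_add sum_distrib_left mult_ac)
  finally show ?thesis .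
qed

lemma loss_closed_form:
  "loss u v C \<beta> \<tau> = survivor_loss C \<tau> (\<lambda>s. C - \<beta> s) \<beta> u v + survivor_loss C \<tau> \<beta> (\<lambda>s. C - \<beta> s) v u"
proof (induction \<tau> arbitrary: \<beta>)
  case (Suc \<tau>)
  show ?case unfolding loss.simps Suc survivor_loss_Suc round_loss_def by (simp add: algebra_simps)
qed (simp add: survivor_loss_def)

lemma V_EAM_eq_loss:
  assumes q: "\<And>i. i \<in> {1..2} \<Longrightarrow> 0 \<le> q i \<and> q i < 1" and pol: "is_policy 2 C \<pi>"
  shows "V_EAM 2 q \<tau> \<pi> = (\<Sum>k<C*\<tau>. q 1 ^ k) + (\<Sum>k<C*\<tau>. q 2 ^ k) -
    loss (q 1) (q 2) C (\<lambda>s. \<pi> (Suc s) {1, 2} 2) \<tau>"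
proof -
  define \<alpha> \<beta> where "\<alpha> = (\<lambda>s. \<pi> (Suc s) {1, 2} 1)" and "\<beta> = (\<lambda>s. \<pi> (Suc s) {1, 2} 2)"
  have sum: "\<alpha> s + \<beta> s = C" for s
    using policy_sum_both[OF pol, of "Suc s"] by (simp add: \<alpha>_def \<beta>_def)
  have \<alpha>: "\<alpha> = (\<lambda>s. C - \<beta> s)"
  proof
    fix s show "\<alpha> s = C - \<beta> s" using sum[of s] by simp
  qed
  have le: "\<alpha> s \<le> C" "\<beta> s \<le> C" for s
    using sum[of s] by auto
  define I where "I = (\<lambda>\<alpha> s. {(\<Sum>r<Suc s. \<alpha> r) + C * (\<tau> - Suc s)..<(\<Sum>r<s. \<alpha> r) + C * (\<tau> - s)})"
  have E: "measure_pmf.expectation (demands 2 q) (\<lambda>L. of_bool (j < L 1 \<and> k < L 2)) = q 1 ^ j * q 2 ^ k" for j k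
    using q by (rule expectation_demands_2)
  have int: "integrable (demands 2 q) (\<lambda>L. of_bool (P L) :: real)" for P
    by (rule measure_pmf.integrable_const_bound[of _ 1]) auto
  \<comment> \<open>The conjuncts \<open>0 < L 2\<close> and \<open>0 < L 1\<close> hold almost
    surely; they bring every indicator into the form of \<open>E\<close>, with exponent 0.\<close>
  have "V_EAM 2 q \<tau> \<pi> = measure_pmf.expectation (demands 2 q) (\<lambda>L.
      (\<Sum>k<C*\<tau>. of_bool (k < L 1 \<and> 0 < L 2)) + (\<Sum>k<C*\<tau>. of_bool (0 < L 1 \<and> k < L 2)) -
      ((\<Sum>s<\<tau>. \<Sum>k\<in>I \<alpha> s. of_bool (k < L 1 \<and> (\<Sum>r<s. \<beta> r) < L 2)) +
       (\<Sum>s<\<tau>. \<Sum>k\<in>I \<beta> s. of_bool ((\<Sum>r<s. \<alpha> r) < L 1 \<and> k < L 2))))"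
    unfolding V_EAM_def
  proof (intro integral_cong_AE AE_pmfI)
    fix L assume L: "L \<in> set_pmf (demands 2 q)"
    have pos: "0 < L 1" "0 < L 2" using demands_pos[OF L] by auto
    have 1: "min (\<Sum>s=1..\<tau>. allocation 2 \<pi> L s 1) (L 1) = min (potential C \<alpha> \<beta> (L 1) (L 2) \<tau>) (L 1)"
      unfolding \<alpha>_def \<beta>_def by (intro allocated_eq_potential pol pos) auto
    have 2: "min (\<Sum>s=1..\<tau>. allocation 2 \<pi> L s 2) (L 2) = min (potential C \<beta> \<alpha> (L 2) (L 1) \<tau>) (L 2)"
      unfolding \<alpha>_def \<beta>_def by (intro allocated_eq_potential pol pos) auto
    show "real (\<Sum>i=1..2. min (\<Sum>t=1..\<tau>. allocation 2 \<pi> L t i) (L i)) =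
      (\<Sum>k<C*\<tau>. of_bool (k < L 1 \<and> 0 < L 2)) + (\<Sum>k<C*\<tau>. of_bool (0 < L 1 \<and> k < L 2)) -
      ((\<Sum>s<\<tau>. \<Sum>k\<in>I \<alpha> s. of_bool (k < L 1 \<and> (\<Sum>r<s. \<beta> r) < L 2)) +
       (\<Sum>s<\<tau>. \<Sum>k\<in>I \<beta> s. of_bool ((\<Sum>r<s. \<alpha> r) < L 1 \<and> k < L 2)))"
      unfolding atLeastAtMost_1_2 using pos
        min_potential[of \<alpha> C \<tau> \<tau> \<beta> "L 1" "L 2"] min_potential[of \<beta> C \<tau> \<tau> \<alpha> "L 2" "L 1"] le
      by (simp add: 1 2 I_def conj_commute del: One_nat_def sum_of_bool_eq)
  qed auto
  also have "\<dots> = (\<Sum>k<C*\<tau>. q 1 ^ k) + (\<Sum>k<C*\<tau>. q 2 ^ k) -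
      ((\<Sum>s<\<tau>. \<Sum>k\<in>I \<alpha> s. q 1 ^ k * q 2 ^ (\<Sum>r<s. \<beta> r)) +
       (\<Sum>s<\<tau>. \<Sum>k\<in>I \<beta> s. q 1 ^ (\<Sum>r<s. \<alpha> r) * q 2 ^ k))"
    by (simp add: Bochner_Integration.integral_sum Bochner_Integration.integral_diff
        Bochner_Integration.integral_add int E
        del: One_nat_def sum_of_bool_eq)
  also have "\<dots> = (\<Sum>k<C*\<tau>. q 1 ^ k) + (\<Sum>k<C*\<tau>. q 2 ^ k) - loss (q 1) (q 2) C \<beta> \<tau>"
    unfolding loss_closed_form survivor_loss_def I_def \<alpha> by (simp add: mult.commute)
  finally show ?thesis unfolding \<beta>_def .
qed

section \<open>Splits chosen by the greedy and fair rules, and the conclusion\<close>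

lemma greedy_locally_optimal:
  assumes s: "greedy_seq q C {1, 2} s" and q: "0 \<le> q 1" "q 1 < 1" "0 \<le> q 2" "q 2 < 1"
  shows "locally_optimal (q 1) (q 2) C (count_list s 2)"
proof -
  have len: "length s = C" and sub: "set s \<subseteq> {1, 2}"
    and greedy: "\<And>k i. k < C \<Longrightarrow> i \<in> {1, 2} \<Longrightarrow>
      q i ^ count_list (take k s) i \<le> q (s ! k) ^ count_list (take k s) (s ! k)"
    using s by (auto simp: greedy_seq_def assignment_seq_def is_arg_max_linorder)
  have sum: "count_list s 1 + count_list s 2 = C"
    using sub unfolding len[symmetric] by (induction s) auto
  \<comment> \<open>Look at the last effector given to \<open>i\<close>: just before it,
    \<open>i\<close> had one effector less than in the end and \<open>j\<close> at most its final
    number, yet \<open>i\<close> was preferred.\<close>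
  have last: "q j ^ count_list s j \<le> q i ^ (count_list s i - 1)"
    if "0 < count_list s i" "i \<in> {1, 2}" "j \<in> {1, 2}" for i j
  proof -
    have "i \<in> set s" using that by (metis count_notin less_irrefl)
    then obtain xs ys where s: "s = xs @ i # ys" "i \<notin> set ys"
      by (auto dest: split_list_last)
    have "q j ^ count_list s j \<le> q j ^ count_list xs j"
      using that q by (intro power_decreasing) (auto simp: s)
    also have "\<dots> \<le> q i ^ count_list xs i"
      using greedy[of "length xs" j] that len by (auto simp: s)
    finally show ?thesis using s by simp
  qed
  have 1: "C - count_list s 2 = count_list s 1" and 2: "C - Suc (count_list s 2) = count_list s 1 - 1"
    using sum by auto
  show "locally_optimal (q 1) (q 2) C (count_list s 2)"
    unfolding locally_optimal_def 1 2 using last[of 1 2] last[of 2 1] sum by auto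
qed

lemma fair_balanced:
  assumes "fair_policy 2 C \<pi>" "1 \<le> t"
  shows "\<pi> t {1, 2} 2 = C div 2 \<or> \<pi> t {1, 2} 2 = C - C div 2"
proof -
  have "fair_for 2 C {1, 2} (\<pi> t {1, 2})"
    using assms unfolding fair_policy_def by (metis insert_not_empty order_refl atLeastAtMost_1_2)
  then have "\<pi> t {1, 2} 1 + \<pi> t {1, 2} 2 = C" "\<bar>int (\<pi> t {1, 2} 1) - int (\<pi> t {1, 2} 2)\<bar> \<in> {0, 1}"
    by (auto simp: fair_for_def)
  then show ?thesis by auto
qed

lemma greedy_policy_locally_optimal:
  assumes "greedy_policy 2 q C \<pi>" "1 \<le> t" and q: "\<And>i. i \<in> {1..2} \<Longrightarrow> 0 \<le> q i \<and> q i < 1"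
  shows "locally_optimal (q 1) (q 2) C (\<pi> t {1, 2} 2)"
proof -
  obtain s where "greedy_seq q C {1, 2} s" "yields 2 s (\<pi> t {1, 2})"
    using assms unfolding greedy_policy_def by (metis insert_not_empty order_refl atLeastAtMost_1_2)
  then show ?thesis
    using greedy_locally_optimal[of q C s] q[of 1] q[of 2] by (simp add: yields_def)
qed

theorem theorem10:
  fixes n C \<tau> :: nat and q :: "nat \<Rightarrow> real" and \<pi>EA \<pi>FA :: policy
  assumes "n = 2" and "C \<ge> 1"
    and "\<And>i. i \<in> {1..n} \<Longrightarrow> 0 \<le> q i \<and> q i < 1"
    and "greedy_policy n q C \<pi>EA"
    and "fair_policy n C \<pi>FA"
    and "same_first_assignments n q C \<pi>EA \<pi>FA"
    and "\<tau> \<ge> 1"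
  shows "V_EAM n q \<tau> \<pi>EA \<ge> V_EAM n q \<tau> \<pi>FA"
proof -
  define \<gamma> \<phi> where "\<gamma> = (\<lambda>s. \<pi>EA (Suc s) {1, 2} 2)" and "\<phi> = (\<lambda>s. \<pi>FA (Suc s) {1, 2} 2)"
  have q: "\<And>i. i \<in> {1..2} \<Longrightarrow> 0 \<le> q i \<and> q i < 1" using assms(1,3) by auto
  have greedy: "greedy_policy 2 q C \<pi>EA" and fair: "fair_policy 2 C \<pi>FA" using assms by auto
  have opt: "locally_optimal (q 1) (q 2) C (\<gamma> s)" for s
    unfolding \<gamma>_def using greedy_policy_locally_optimal[OF greedy _ q] by simp
  then have \<gamma>: "\<gamma> s \<le> C" for s by (auto simp: locally_optimal_def)
  have bal: "\<phi> s = C div 2 \<or> \<phi> s = C - C div 2" for s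
    unfolding \<phi>_def using fair_balanced[OF fair] by simp
  have \<phi>: "\<phi> s \<le> C" for s using bal[of s] by auto
  have "loss (q 1) (q 2) C \<gamma> \<tau> \<le> loss (q 1) (q 2) C \<phi> \<tau>"
  proof (cases "C = 1")
    \<comment> \<open>A single effector meets the tie \<open>q i ^ 0 = 1\<close>, so local
      optimality decides nothing; the common order makes both policies serve the same
      threat.\<close>
    case True
    have "\<gamma> s = \<phi> s" for s
    proof -
      obtain r s1 s2 where "length s1 = C" "length s2 = C"
          "take (min C (card {1, 2::nat})) s1 = take (min C (card {1, 2::nat})) r"
          "take (min C (card {1, 2::nat})) s2 = take (min C (card {1, 2::nat})) r"
        and y: "yields 2 s1 (\<pi>EA (Suc s) {1, 2})" "yields 2 s2 (\<pi>FA (Suc s) {1, 2})"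
        using assms(6)[unfolded same_first_assignments_def \<open>n = 2\<close>, rule_format, of "Suc s" "{1, 2}"]
        unfolding atLeastAtMost_1_2 by (auto simp: greedy_seq_def assignment_seq_def)
      then have "s1 = s2" using \<open>C = 1\<close> by simp
      then show ?thesis using y by (simp add: yields_def \<gamma>_def \<phi>_def)
    qed
    then have "\<gamma> = \<phi>" by auto
    then show ?thesis by simp
  next
    case False
    then have C: "2 \<le> C" using assms(2) by simp
    show ?thesis
    proof (cases "q 1 \<le> q 2")
      case True
      then show ?thesis using loss_locally_optimal_le_balanced[OF _ True _ C opt bal] q[of 1] q[of 2] by simp
    next
      case False
      \<comment> \<open>Renaming the threats puts the smaller failure probability first and turns a
        split \<open>b\<close> into \<open>C - b\<close>.\<close>
      have "loss (q 2) (q 1) C (\<lambda>s. C - \<gamma> s) \<tau> \<le> loss (q 2) (q 1) C (\<lambda>s. C - \<phi> s) \<tau>"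
      proof (rule loss_locally_optimal_le_balanced)
        show "locally_optimal (q 2) (q 1) C (C - \<gamma> s)" for s
          using opt by (rule locally_optimal_swap)
        show "C - \<phi> s = C div 2 \<or> C - \<phi> s = C - C div 2" for s
          using bal[of s] by auto
      qed (use False C q[of 1] q[of 2] in auto)
      then show ?thesis using \<gamma> \<phi> by (simp add: loss_swap)
    qed
  qed
  then show ?thesis
    using V_EAM_eq_loss[of q C \<pi>EA \<tau>] V_EAM_eq_loss[of q C \<pi>FA \<tau>] q greedy fair
    by (simp add: \<open>n = 2\<close> \<gamma>_def \<phi>_def greedy_policy_def fair_policy_def)
qed

end
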